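(* Let $g\in A_n$. For $i\ge 1$ let $m_i$ be the number of cycles of length $i$ in the cycle decomposition of $g$, and let $p_i=\lfloor m_i/2\rfloor$. Then there exists $h\in A_n$ with $g=h^2$ if and only if $m_{2k}\equiv 0 \pmod 2$ for every $k\ge 1$ and at least one of the following two conditions holds: 1) $|\mathrm{Fix}(g)|>1$ or $\max_{k\in\mathbb N} m_{2k-1}>1$; 2) $\sum_{l\ge 1} p_{2l}\equiv 0\pmod 2$. Moreover, for the existence of a square root over $S_n$ condition 1) is dropped and condition 2) is replaced by: $m_{2l}\equiv 0\pmod 2$ for all $l\ge 1$; that is, $g$ is the square of an element of $S_n$ if and only if $m_{2l}\equiv 0\pmod 2$ for all $l\ge1$.
   Context: $S_n$ and $A_n$ are the symmetric and alternating groups on $\{1,\dots,n\}$. $|\mathrm{Fix}(g)|$ denotes the number of elements of $\{1,\dots,n\}$ fixed by $g$. The number $p_l$ is the number of pairs of $l$-cycles in the cycle decomposition of $g$. *)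

theory Defs
  imports "HOL-Algebra.Sym_Groups" "HOL-Combinatorics.Orbits"
begin

text \<open>
  The cycles in the cycle decomposition of a permutation \<open>g\<close> of \<open>{1..n}\<close> are identified with
  their supports, i.e. with the nonempty subsets of \<open>{1..n}\<close> that form a single orbit of \<open>g\<close>.
  A fixed point is a cycle of length 1.
\<close>

definition cycles_of_length :: "nat \<Rightarrow> (nat \<Rightarrow> nat) \<Rightarrow> nat \<Rightarrow> nat set set" where
  "cycles_of_length n g i = {C. C \<subseteq> {1..n} \<and> cyclic_on g C \<and> card C = i}"

definition num_cycles :: "nat \<Rightarrow> (nat \<Rightarrow> nat) \<Rightarrow> nat \<Rightarrow> nat" where
  "num_cycles n g i = card (cycles_of_length n g i)"

definition num_cycle_pairs :: "nat \<Rightarrow> (nat \<Rightarrow> nat) \<Rightarrow> nat \<Rightarrow> nat" where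
  "num_cycle_pairs n g i = num_cycles n g i div 2"

definition Fix :: "nat \<Rightarrow> (nat \<Rightarrow> nat) \<Rightarrow> nat set" where
  "Fix n g = {x \<in> {1..n}. g x = x}"

text \<open>
  Cycles longer than \<open>n\<close> do not occur, so a sum over all \<open>l \<ge> 1\<close> of cycle pair counts may be
  taken over \<open>l \<le> n\<close>, and a maximum over all cycle lengths is the maximum of a finite set of
  values.
\<close>

lemma num_cycles_eq_0:
  assumes "i > n"
  shows "num_cycles n g i = 0"
proof -
  have "card C \<le> n" if "C \<subseteq> {1..n}" for C
    using card_mono[OF _ that] by simp
  then have "cycles_of_length n g i = {}"
    using assms unfolding cycles_of_length_def by (auto simp: not_le[symmetric])
  then show ?thesis
    by (simp add: num_cycles_def)
qed

lemma finite_range_num_cycles: "finite ((\<lambda>k. num_cycles n g (f k)) ` A)"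
proof -
  have "(\<lambda>k. num_cycles n g (f k)) ` A \<subseteq> insert 0 (num_cycles n g ` {..n})"
  proof (rule image_subsetI)
    fix k assume "k \<in> A"
    show "num_cycles n g (f k) \<in> insert 0 (num_cycles n g ` {..n})"
      by (cases "f k \<le> n") (simp_all add: num_cycles_eq_0)
  qed
  then show ?thesis
    by (rule finite_subset) simp
qed

end

theory Submission
  imports Defs
begin

text \<open>
  Squaring a permutation \<open>h\<close> keeps a cycle of odd length as a single cycle and splits a cycle of
  length \<open>2 * i\<close> into two of length \<open>i\<close> (\<open>cycle_count_square\<close>). So in \<open>g = h \<circ> h\<close> every cycle of even
  length belongs to a pair that \<open>h\<close> joins to one cycle of twice the length, while cycles of odd length
  are either joined in pairs or roots of themselves. Conversely, any choice of pairs of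
  cycles of equal length that exhausts the even ones comes from a root (\<open>ex_square_root\<close>):
  a chosen pair is interleaved to a single cycle (\<open>ex_merged_cycle\<close>), and on the remaining odd cycles \<open>g\<close>
  has odd order, so that a power of \<open>g\<close> is a root (\<open>odd_cycles_power_root\<close>). Hence \<open>g\<close> is a square in the
  symmetric group iff the number of cycles of each even length is even.

  The cycles of even length of \<open>h\<close> are exactly the joined pairs, and a permutation is even iff it
  has an even number of such cycles (\<open>evenperm_iff_even_cycles\<close>). A root in the alternating group
  therefore amounts to a choice of an even number of pairs. The pairs of even cycles are forced,
  which gives the parity condition on their number. The only freedom lies in pairs of odd cycles of equal
  length: one such pair, if present, can be joined or left alone so as to correct the parity.
\<close>

section \<open>Counting the cycles of a permutation\<close>

definition cycle_count :: "('a \<Rightarrow> 'a) \<Rightarrow> 'a set \<Rightarrow> nat \<Rightarrow> nat" where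
  "cycle_count f S i = card {C. C \<subseteq> S \<and> cyclic_on f C \<and> card C = i}"

lemma cyclic_on_nonempty: "cyclic_on f C \<Longrightarrow> C \<noteq> {}"
  unfolding cyclic_on_def by blast

text \<open>
  An orbit cannot leave a set that the map sends into itself; hence a cycle inside two such sets
  never straddles them. This is what makes the cycle count additive over invariant parts.
\<close>

lemma cyclic_on_subset_cases:
  assumes "cyclic_on f C" "C \<subseteq> A \<union> B" "f \<in> A \<rightarrow> A" "f \<in> B \<rightarrow> B"
  shows "C \<subseteq> A \<or> C \<subseteq> B"
proof -
  obtain s where s: "s \<in> C" "C = orbit f s"
    using assms(1) by (auto simp: cyclic_on_def)
  have "orbit f s \<subseteq> T" if "s \<in> T" "f \<in> T \<rightarrow> T" for T
  proof
    fix y assume "y \<in> orbit f s"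
    then show "y \<in> T" by induction (use that in auto)
  qed
  then show ?thesis using s assms by blast
qed

lemma cycle_count_Un:
  assumes "f \<in> A \<rightarrow> A" "f \<in> B \<rightarrow> B" "A \<inter> B = {}" "finite A" "finite B"
  shows "cycle_count f (A \<union> B) i = cycle_count f A i + cycle_count f B i"
proof -
  let ?N = "\<lambda>S. {C. C \<subseteq> S \<and> cyclic_on f C \<and> card C = i}"
  have "?N (A \<union> B) = ?N A \<union> ?N B"
    using cyclic_on_subset_cases[of f _ A B] assms(1,2) by blast
  moreover have "?N A \<inter> ?N B = {}"
    using assms(3) cyclic_on_nonempty[of f] by blast
  moreover have "finite (?N A)" "finite (?N B)"
    using assms(4,5) by auto
  ultimately show ?thesis
    by (simp add: cycle_count_def card_Un_disjoint)
qed

lemma cycle_count_empty: "cycle_count f {} i = 0"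
proof -
  have "{C. C \<subseteq> {} \<and> cyclic_on f C \<and> card C = i} = {}"
    by (auto simp: cyclic_on_def)
  then show ?thesis by (simp add: cycle_count_def del: subset_empty)
qed

lemma cycle_count_0: "cycle_count f S 0 = 0"
proof -
  have "\<not> (cyclic_on f C \<and> card C = 0)" for C
    using cyclic_on_nonempty[of f C] finite_cyclic_on[of f C] by auto
  then have "{C. C \<subseteq> S \<and> cyclic_on f C \<and> card C = 0} = {}" by blast
  then show ?thesis unfolding cycle_count_def by (simp only: card.empty)
qed

lemma cycle_count_cyclic:
  assumes "cyclic_on f A"
  shows "cycle_count f A i = of_bool (card A = i)"
proof -
  have "C = A" if "C \<subseteq> A" "cyclic_on f C" for C
  proof -
    obtain s where "s \<in> C" using \<open>cyclic_on f C\<close> by (auto simp: cyclic_on_def)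
    then show ?thesis using that assms orbit_cyclic_eq3[of f _ s] by blast
  qed
  then have "{C. C \<subseteq> A \<and> cyclic_on f C \<and> card C = i} = (if card A = i then {A} else {})"
    using assms by auto
  then show ?thesis by (simp add: cycle_count_def)
qed

lemma cycle_count_cong:
  assumes "\<And>x. x \<in> S \<Longrightarrow> f x = g x"
  shows "cycle_count f S i = cycle_count g S i"
proof -
  have "cyclic_on f C \<longleftrightarrow> cyclic_on g C" if "C \<subseteq> S" for C
    by (rule cyclic_cong) (use assms that in auto)
  then show ?thesis
    unfolding cycle_count_def by (metis (no_types, lifting))
qed

lemma cyclic_on_disjoint:
  assumes "cyclic_on f C" "cyclic_on f D" "C \<noteq> D"
  shows "C \<inter> D = {}"
  using assms orbit_cyclic_eq3 by (metis disjoint_iff)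

lemma perm_restrict_permutes:
  assumes "f permutes S" "finite A" "f \<in> A \<rightarrow> A"
  shows "perm_restrict f A permutes A"
proof (rule bij_imp_permutes)
  have inj: "inj_on f A"
    using permutes_inj[OF assms(1)] by (rule inj_on_subset) simp
  moreover have "f ` A = A"
    using endo_inj_surj[OF assms(2) _ inj] assms(3) by blast
  ultimately have "bij_betw f A A" by (simp add: bij_betw_def)
  then show "bij_betw (perm_restrict f A) A A"
    by (subst bij_betw_cong[where g = f]) (simp_all add: perm_restrict_simps)
qed (simp add: perm_restrict_simps)

lemma permutes_Diff_cyclic_closed:
  assumes "f permutes S" "cyclic_on f C"
  shows "f \<in> S - C \<rightarrow> S - C"
  using assms cyclic_on_f_in[OF assms] by (auto simp: permutes_in_image)

lemma cycle_count_remove: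
  assumes "f permutes S" "finite S" "C \<subseteq> S" "cyclic_on f C"
  shows "cycle_count f S i = of_bool (card C = i) + cycle_count f (S - C) i"
proof -
  have "cycle_count f (C \<union> (S - C)) i = cycle_count f C i + cycle_count f (S - C) i"
    using assms(2) permutes_Diff_cyclic_closed[OF assms(1,4)]
      cyclic_on_inI[OF assms(4)] finite_cyclic_on[OF assms(4)]
    by (intro cycle_count_Un) auto
  moreover have "C \<union> (S - C) = S" using assms(3) by blast
  ultimately show ?thesis by (simp add: cycle_count_cyclic[OF assms(4)])
qed

text \<open>
  Facts about cycle structure are proved by splitting off one cycle at a time. The rule leaves
  open which cycle \<open>C\<close> is removed, so the step must be proved for every one.
\<close>

lemma permutes_cycle_induct [consumes 2, case_names empty cycle]:
  assumes "finite S" "f permutes S"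
    and "P id {}"
    and "\<And>f S C. \<lbrakk>finite S; f permutes S; C \<subseteq> S; cyclic_on f C;
           P (perm_restrict f (S - C)) (S - C)\<rbrakk> \<Longrightarrow> P f S"
  shows "P f S"
  using assms(1,2)
proof (induction arbitrary: f rule: finite_psubset_induct)
  case (psubset S)
  show ?case
  proof (cases "S = {}")
    case True
    then show ?thesis using psubset.prems assms(3) by (simp add: id_def)
  next
    case False
    then obtain x where x: "x \<in> S" by blast
    let ?C = "orbit f x"
    have C: "cyclic_on f ?C" by (rule cyclic_on_orbit[OF psubset.prems psubset.hyps(1)])
    have sub: "?C \<subseteq> S" by (rule permutes_orbit_subset[OF psubset.prems x])
    have "S - ?C \<subset> S" using sub orbit_nonempty[of f x] by blast
    then have "P (perm_restrict f (S - ?C)) (S - ?C)"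
      by (rule psubset.IH[OF _ perm_restrict_diff_cyclic[OF psubset.prems C]])
    then show ?thesis by (rule assms(4)[OF psubset.hyps(1) psubset.prems sub C])
  qed
qed

section \<open>Parity and cycles of even length\<close>

text \<open>
  The two descriptions of the cycle through a point, as an orbit and as the duplicate-free list of
  iterates, agree; with it the results on the least period of a point become results
  on the size of its orbit.
\<close>

lemma
  assumes "permutation f"
  shows orbit_eq_set_support: "orbit f x = set (support f x)"
    and card_orbit: "card (orbit f x) = least_power f x"
proof -
  show eq: "orbit f x = set (support f x)"
    unfolding support_set[OF assms] orbit_altdef_permutation[OF assms] by blast
  show "card (orbit f x) = least_power f x"
    unfolding eq using distinct_card[OF cycle_of_permutation[OF assms, of x]] by simp
qed

lemma funpow_fixes_iff_card_dvd:
  assumes "permutation f" "cyclic_on f C" "x \<in> C"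
  shows "(f ^^ n) x = x \<longleftrightarrow> card C dvd n"
  using card_orbit[OF assms(1), of x] least_power_dvd[OF assms(1), of x n]
    orbit_cyclic_eq3[OF assms(2,3)] by simp

text \<open>
  A list of length \<open>m > 0\<close> gives a product of \<open>m - 1\<close> transpositions.
\<close>

lemma evenperm_cycle_of_list:
  assumes "cs \<noteq> []" "distinct cs"
  shows "evenperm (cycle_of_list cs) \<longleftrightarrow> odd (length cs)"
  using assms
proof (induction cs rule: cycle_of_list.induct)
  case (1 i j cs)
  then show ?case
    by (simp add: evenperm_comp permutation_swap_id permutation_of_cycle evenperm_swap del: o_apply)
       
qed simp_all

lemma evenperm_perm_restrict_cyclic:
  assumes "permutation f" "cyclic_on f C"
  shows "evenperm (perm_restrict f C) \<longleftrightarrow> odd (card C)"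
proof -
  obtain x where x: "x \<in> C" "C = orbit f x" using assms(2) by (auto simp: cyclic_on_def)
  note C = x(2)[unfolded orbit_eq_set_support[OF assms(1)]]
  have "perm_restrict f C = cycle_of_list (support f x)"
    using cycle_restrict[OF assms(1)] id_outside_supp[of _ "support f x"]
    by (auto simp: fun_eq_iff perm_restrict_def C)
  moreover have "support f x \<noteq> []" using x(1) C by fastforce
  ultimately show ?thesis
    using evenperm_cycle_of_list[OF _ cycle_of_permutation[OF assms(1)]] x(2) card_orbit[OF assms(1)]
    by simp
qed

text \<open>
  A cycle of length \<open>m\<close> has sign \<open>(-1) ^ (m - 1)\<close>, so only cycles of even length matter.
  The summation bound \<open>M\<close> is independent of \<open>S\<close> because \<open>S\<close> shrinks in the induction.
\<close>

lemma evenperm_iff_even_cycles: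
  assumes "finite S" "f permutes S" "card S \<le> M"
  shows "evenperm f \<longleftrightarrow> even (\<Sum>i=1..M. cycle_count f S (2 * i))"
  using assms
proof (induction rule: permutes_cycle_induct)
  case empty
  show ?case by (simp add: cycle_count_empty)
next
  case (cycle f S C)
  let ?g = "perm_restrict f (S - C)"
  have perm: "permutation f" using cycle(1,2) unfolding permutation_permutes by blast
  have restr: "perm_restrict f C permutes C" "?g permutes (S - C)"
    using perm_restrict_permutes[OF cycle(2), of C] perm_restrict_diff_cyclic[OF cycle(2,4)]
      finite_cyclic_on[OF cycle(4)] cyclic_on_inI[OF cycle(4)]
    by auto
  have "f = perm_restrict f C \<circ> ?g"
    using perm_restrict_union[OF restr] cycle(2,3) by (simp add: Un_absorb1)
  moreover have p: "permutation (perm_restrict f C)" "permutation ?g"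
    using restr finite_cyclic_on[OF cycle(4)] cycle(1) unfolding permutation_permutes by blast+
  ultimately have "evenperm f \<longleftrightarrow> (odd (card C) \<longleftrightarrow> evenperm ?g)"
    using evenperm_comp[OF p] evenperm_perm_restrict_cyclic[OF perm cycle(4)] by simp
  moreover have "evenperm ?g \<longleftrightarrow> even (\<Sum>i=1..M. cycle_count f (S - C) (2 * i))"
  proof -
    have "card (S - C) \<le> M"
      using card_mono[OF cycle(1), of "S - C"] cycle.prems by auto
    moreover have "cycle_count ?g (S - C) i = cycle_count f (S - C) i" for i
      by (rule cycle_count_cong) (simp add: perm_restrict_def)
    ultimately show ?thesis using cycle.IH by simp
  qed
  moreover have "(\<Sum>i=1..M. cycle_count f S (2 * i)) =
      of_bool (even (card C)) + (\<Sum>i=1..M. cycle_count f (S - C) (2 * i))"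
  proof -
    have pos: "0 < card C" "card C \<le> M"
      using card_mono[OF cycle(1,3)] cycle.prems finite_cyclic_on[OF cycle(4)] cyclic_on_nonempty[OF cycle(4)]
      by (auto simp: card_gt_0_iff)
    have "(\<Sum>i=1..M. of_bool (card C = 2 * i)) = (of_bool (even (card C)) :: nat)"
    proof (cases "even (card C)")
      case True
      then obtain k where "card C = 2 * k" by blast
      then show ?thesis using pos by (simp add: of_bool_def)
    qed (auto intro: sum.neutral)
    then show ?thesis
      using cycle_count_remove[OF cycle(2,1,3,4)] by (simp add: sum.distrib)
  qed
  ultimately show ?case by auto
qed

section \<open>The cycles of a square\<close>

lemma orbit_funpow_subset:
  assumes "0 < k"
  shows "orbit (f ^^ k) x \<subseteq> orbit f x"
proof
  fix y assume "y \<in> orbit (f ^^ k) x"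
  then obtain n where "0 < n" "y = (f ^^ (k * n)) x"
    unfolding orbit_altdef funpow_mult by blast
  moreover have "0 < k * n" using \<open>0 < n\<close> assms by simp
  ultimately show "y \<in> orbit f x" unfolding orbit_altdef by blast
qed

text \<open>
  The cycle is covered by the \<open>h \<circ> h\<close>-orbits \<open>D\<close> of a point \<open>x\<close> and \<open>E\<close> of \<open>h x\<close>, and \<open>h\<close>
  maps \<open>D\<close> bijectively onto \<open>E\<close>. If the two orbits differ, they are disjoint halves. If they coincide,
  the length \<open>m\<close> of the cycle is odd: for \<open>m = 2 * l\<close> the power \<open>(h \<circ> h) ^^ l\<close> fixes \<open>x\<close>, whence
  \<open>m\<close> would divide its half \<open>l\<close>.
\<close>

lemma square_of_cycle:
  assumes "permutation h" "cyclic_on h C"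
  obtains (odd) "odd (card C)" "cyclic_on (h \<circ> h) C"
  | (even) D E where "C = D \<union> E" "D \<inter> E = {}" "cyclic_on (h \<circ> h) D" "cyclic_on (h \<circ> h) E"
      "card C = 2 * card D" "card C = 2 * card E"
proof -
  let ?g = "h \<circ> h"
  have perm: "permutation ?g" using permutation_compose assms(1) by blast
  obtain x where x: "x \<in> C" "C = orbit h x" using assms(2) unfolding cyclic_on_def by blast
  define D E where "D = orbit ?g x" and "E = orbit ?g (h x)"
  have D: "cyclic_on ?g D" and E: "cyclic_on ?g E"
    unfolding D_def E_def by (rule cyclic_on_orbit'[OF perm])+
  have E_image: "E = h ` D"
    unfolding D_def E_def
    by (rule orbit_inverse[OF permutation_self_in_orbit[OF perm], symmetric]) simp
  have inj: "inj h" using assms(1) by (simp add: permutation bij_is_inj)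
  have card: "card D = card E"
    unfolding E_image by (rule card_image[symmetric], rule inj_on_subset[OF inj]) simp
  have C: "C = D \<union> E"
  proof
    have "D \<subseteq> C"
      using orbit_funpow_subset[of 2 h x] by (simp add: D_def x(2) numeral_2_eq_2)
    then show "D \<union> E \<subseteq> C"
      unfolding E_image using cyclic_on_inI[OF assms(2)] by blast
    show "C \<subseteq> D \<union> E"
    proof
      fix y assume "y \<in> C"
      then show "y \<in> D \<union> E"
        unfolding x(2)
      proof induction
        case base
        show ?case unfolding E_def using permutation_self_in_orbit[OF perm] by blast
      next
        case (step y)
        have "h y \<in> D" if "y \<in> E"
          using that cyclic_on_inI[OF D] unfolding E_image by auto
        then show ?case using step.IH unfolding E_image by blast
      qed
    qed
  qed
  show thesis
  proof (cases "D = E")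
    case True
    have "odd (card C)"
    proof
      assume "even (card C)"
      then obtain l where l: "card C = 2 * l" by blast
      have "(h ^^ (2 * l)) x = x"
        using funpow_fixes_iff_card_dvd[OF assms x(1)] l by simp
      then have "(?g ^^ l) x = x"
        using funpow_mult[where m = 2 and n = l and f = h] by (simp add: numeral_2_eq_2 mult.commute)
      moreover have "cyclic_on ?g C" using True C D by simp
      ultimately have "card C dvd l"
        using funpow_fixes_iff_card_dvd[OF perm _ x(1)] by blast
      moreover have "0 < card C"
        using x(1) finite_cyclic_on[OF assms(2)] by (auto simp: card_gt_0_iff)
      ultimately show False using l by (auto dest: dvd_imp_le)
    qed
    then show thesis using odd True C D by simp
  next
    case False
    have disj: "D \<inter> E = {}" by (rule cyclic_on_disjoint[OF D E False])
    then have "card C = card D + card E"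
      unfolding C using finite_cyclic_on[OF D] finite_cyclic_on[OF E] by (simp add: card_Un_disjoint)
    then show thesis using even[OF C disj D E] card by simp
  qed
qed

text \<open>
  The cycles of length \<open>i\<close> of a square come from halving a cycle of length \<open>2 * i\<close>, or, when \<open>i\<close>
  is odd, from a single cycle of length \<open>i\<close>.
\<close>

lemma cycle_count_square:
  assumes "finite S" "h permutes S"
  shows "cycle_count (h \<circ> h) S i =
    2 * cycle_count h S (2 * i) + (if odd i then cycle_count h S i else 0)"
  using assms
proof (induction rule: permutes_cycle_induct)
  case empty
  show ?case by (simp add: cycle_count_empty)
next
  case (cycle h S C)
  have perm: "permutation h" using cycle(1,2) unfolding permutation_permutes by blast
  let ?h' = "perm_restrict h (S - C)"
  have closed: "h \<in> C \<rightarrow> C" "h \<in> S - C \<rightarrow> S - C"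
    using cyclic_on_inI[OF cycle(4)] permutes_Diff_cyclic_closed[OF cycle(2,4)] by auto
  then have closed2: "h \<circ> h \<in> C \<rightarrow> C" "h \<circ> h \<in> S - C \<rightarrow> S - C"
    unfolding Pi_iff comp_def by blast+
  have fin: "finite C" "finite (S - C)" using finite_cyclic_on[OF cycle(4)] cycle(1) by auto
  have C_part: "cycle_count (h \<circ> h) C i =
      2 * of_bool (card C = 2 * i) + (if odd i then of_bool (card C = i) else 0)"
    using perm cycle(4)
  proof (cases rule: square_of_cycle)
    case odd
    then show ?thesis by (auto simp: cycle_count_cyclic odd_pos)
  next
    case (even D E)
    have "cycle_count (h \<circ> h) (D \<union> E) i = cycle_count (h \<circ> h) D i + cycle_count (h \<circ> h) E i"
      using even(2) cyclic_on_inI[OF even(3)] cyclic_on_inI[OF even(4)]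
        finite_cyclic_on[OF even(3)] finite_cyclic_on[OF even(4)]
      by (intro cycle_count_Un) auto
    then show ?thesis
      using even(1,5,6) by (auto simp: cycle_count_cyclic[OF even(3)] cycle_count_cyclic[OF even(4)])
  qed
  have S: "C \<union> (S - C) = S" using cycle(3) by blast
  have "cycle_count (h \<circ> h) (C \<union> (S - C)) i =
      cycle_count (h \<circ> h) C i + cycle_count (h \<circ> h) (S - C) i"
    using closed2 fin by (intro cycle_count_Un) auto
  also have "cycle_count (h \<circ> h) (S - C) i = cycle_count (?h' \<circ> ?h') (S - C) i"
    using closed(2) by (intro cycle_count_cong) (auto simp: perm_restrict_def)
  also have "\<dots> = 2 * cycle_count ?h' (S - C) (2 * i) +
      (if odd i then cycle_count ?h' (S - C) i else 0)"
    by (rule cycle.IH)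
  also have "cycle_count ?h' (S - C) = cycle_count h (S - C)"
    by (intro ext cycle_count_cong) (simp add: perm_restrict_def)
  finally show ?case
    unfolding S C_part cycle_count_remove[OF cycle(2,1,3,4)] by simp
qed

section \<open>Construction of square roots\<close>

text \<open>
  Choosing base points \<open>c\<close> and \<open>d\<close>, one sends \<open>(g ^^ n) c\<close> to \<open>(g ^^ n) d\<close>. This does not depend on the
  exponent, since both points have the same period, namely the common length of the cycles.
\<close>

lemma ex_equivariant_bij:
  assumes "permutation g" "cyclic_on g C" "cyclic_on g D" "card C = card D"
  obtains \<phi> where "bij_betw \<phi> C D" "\<And>y. y \<in> C \<Longrightarrow> \<phi> (g y) = g (\<phi> y)"
proof -
  obtain c where c: "c \<in> C" using cyclic_on_nonempty[OF assms(2)] by blast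
  obtain d where d: "d \<in> D" using cyclic_on_nonempty[OF assms(3)] by blast
  have Cn: "C = {(g ^^ n) c |n. True}"
    using orbit_cyclic_eq3[OF assms(2) c] orbit_altdef_permutation[OF assms(1), of c] by simp
  have Dn: "D = {(g ^^ n) d |n. True}"
    using orbit_cyclic_eq3[OF assms(3) d] orbit_altdef_permutation[OF assms(1), of d] by simp
  have inj: "inj g" using assms(1) by (simp add: permutation bij_is_inj)
  have le: "(g ^^ a) d = (g ^^ b) d" if "(g ^^ a) c = (g ^^ b) c" "a \<le> b" for a b
  proof -
    have "(g ^^ (b - a)) c = c" by (rule funpow_diff[OF inj that(2,1)])
    then have "(g ^^ (b - a)) d = d"
      using funpow_fixes_iff_card_dvd[OF assms(1,2) c] funpow_fixes_iff_card_dvd[OF assms(1,3) d]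
        assms(4) by simp
    moreover have "(g ^^ b) d = (g ^^ a) ((g ^^ (b - a)) d)"
      using that(2) funpow_add[of a "b - a" g] by simp
    ultimately show ?thesis by simp
  qed
  have well_def: "(g ^^ a) d = (g ^^ b) d" if "(g ^^ a) c = (g ^^ b) c" for a b
    using le[OF that] le[OF that[symmetric], symmetric] nat_le_linear[of a b] by blast
  define \<phi> where "\<phi> y = (g ^^ (SOME n. (g ^^ n) c = y)) d" for y
  have \<phi>: "\<phi> ((g ^^ n) c) = (g ^^ n) d" for n
    unfolding \<phi>_def
    by (rule well_def, rule someI[where P = "\<lambda>m. (g ^^ m) c = (g ^^ n) c" and x = n]) (rule refl)
  have image: "\<phi> ` C = D"
  proof -
    have "\<phi> ` range (\<lambda>n. (g ^^ n) c) = range (\<lambda>n. (g ^^ n) d)"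
      by (simp add: image_image \<phi>)
    then show ?thesis unfolding Cn Dn by (simp add: full_SetCompr_eq)
  qed
  show thesis
  proof (rule that)
    have "inj_on \<phi> C"
      by (rule eq_card_imp_inj_on[OF finite_cyclic_on[OF assms(2)]]) (simp only: image assms(4))
    then show "bij_betw \<phi> C D" using image by (simp add: bij_betw_def)
    fix y assume "y \<in> C"
    then obtain n where n: "y = (g ^^ n) c" unfolding Cn by blast
    show "\<phi> (g y) = g (\<phi> y)" using \<phi>[of "Suc n"] \<phi>[of n] n by simp
  qed
qed

text \<open>
  Two cycles of equal length interleave to one cycle of twice the length whose square they are:
  with an equivariant bijection \<open>\<phi>\<close> from \<open>C\<close> to \<open>D\<close>, the root is \<open>\<phi>\<close> on \<open>C\<close> and \<open>g\<close> after the
  inverse of \<open>\<phi>\<close> on \<open>D\<close>.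
\<close>

lemma ex_merged_cycle:
  assumes "permutation g" "cyclic_on g C" "cyclic_on g D" "C \<inter> D = {}" "card C = card D"
  obtains r where "r permutes C \<union> D" "cyclic_on r (C \<union> D)"
    "\<And>x. x \<in> C \<union> D \<Longrightarrow> r (r x) = g x"
proof -
  obtain \<phi> where \<phi>: "bij_betw \<phi> C D" and equi: "\<And>y. y \<in> C \<Longrightarrow> \<phi> (g y) = g (\<phi> y)"
    using ex_equivariant_bij[OF assms(1,2,3,5)] by blast
  define \<psi> where "\<psi> = inv_into C \<phi>"
  define r where "r y = (if y \<in> C then \<phi> y else if y \<in> D then g (\<psi> y) else y)" for y
  have \<phi>_in: "\<phi> y \<in> D" if "y \<in> C" for y using \<phi> that by (rule bij_betwE[rule_format])
  have \<psi>\<phi>: "\<psi> (\<phi> y) = y" if "y \<in> C" for y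
    unfolding \<psi>_def by (rule bij_betw_inv_into_left[OF \<phi> that])
  have \<phi>\<psi>: "\<phi> (\<psi> z) = z" if "z \<in> D" for z
    unfolding \<psi>_def by (rule bij_betw_inv_into_right[OF \<phi> that])
  have \<psi>_in: "\<psi> z \<in> C" if "z \<in> D" for z
    using bij_betw_inv_into[OF \<phi>] that unfolding \<psi>_def by (rule bij_betwE[rule_format])
  have rC: "r y = \<phi> y" if "y \<in> C" for y using that by (simp add: r_def)
  have rD: "r z = g (\<psi> z)" if "z \<in> D" for z using that assms(4) by (auto simp: r_def)
  have r_in_D: "r y \<in> D" if "y \<in> C" for y using that by (simp add: rC \<phi>_in)
  have r_in_C: "r z \<in> C" if "z \<in> D" for z
    using that by (simp add: rD \<psi>_in cyclic_on_inI[OF assms(2)])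
  have square: "r (r x) = g x" if "x \<in> C \<union> D" for x
    using that
  proof
    assume "x \<in> C"
    then show ?thesis using rD[OF r_in_D[OF \<open>x \<in> C\<close>]] by (simp add: rC \<psi>\<phi>)
  next
    assume "x \<in> D"
    have "r (r x) = \<phi> (g (\<psi> x))" using rC[OF r_in_C[OF \<open>x \<in> D\<close>]] by (simp add: rD \<open>x \<in> D\<close>)
    also have "\<dots> = g (\<phi> (\<psi> x))" by (rule equi[OF \<psi>_in[OF \<open>x \<in> D\<close>]])
    finally show ?thesis by (simp add: \<phi>\<psi> \<open>x \<in> D\<close>)
  qed
  have perm: "r permutes C \<union> D"
  proof (rule bij_imp_permutes)
    have inj: "inj_on r (C \<union> D)"
    proof (rule inj_onI)
      fix x y assume "x \<in> C \<union> D" "y \<in> C \<union> D" "r x = r y"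
      then have "g x = g y" using square[of x] square[of y] by simp
      then show "x = y" using assms(1) by (simp add: permutation bij_is_inj inj_eq)
    qed
    have "r ` (C \<union> D) \<subseteq> C \<union> D" using r_in_C r_in_D by blast
    then have "r ` (C \<union> D) = C \<union> D"
      using endo_inj_surj[OF _ _ inj] finite_cyclic_on[OF assms(2)] finite_cyclic_on[OF assms(3)] by blast
    then show "bij_betw r (C \<union> D) (C \<union> D)" using inj by (simp add: bij_betw_def)
  qed (simp add: r_def)
  obtain c where c: "c \<in> C" using cyclic_on_nonempty[OF assms(2)] by blast
  have cyc: "cyclic_on (r \<circ> r) T" if "cyclic_on g T" "T \<subseteq> C \<union> D" for T
  proof -
    have "cyclic_on (r \<circ> r) T = cyclic_on g T"
      by (rule cyclic_cong) (use square that(2) in auto)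
    then show ?thesis using that(1) by simp
  qed
  have orbit_square: "orbit (r \<circ> r) x \<subseteq> orbit r x" for x
    using orbit_funpow_subset[of 2 r x] by (simp add: numeral_2_eq_2)
  \<comment> \<open>The square of \<open>r\<close> already runs through all of \<open>C\<close> from \<open>c\<close> and through all of \<open>D\<close> from \<open>r c\<close>.\<close>
  have "C \<subseteq> orbit r c"
    using orbit_square[of c] orbit_cyclic_eq3[OF cyc[OF assms(2)] c] by simp
  moreover have "D \<subseteq> orbit r c"
  proof -
    have "D = orbit (r \<circ> r) (r c)"
      using orbit_cyclic_eq3[OF cyc[OF assms(3)] r_in_D[OF c]] by simp
    also have "\<dots> \<subseteq> orbit r (r c)" by (rule orbit_square)
    also have "\<dots> \<subseteq> orbit r c" using orbit_subset[of _ r c] by blast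
    finally show ?thesis .
  qed
  moreover have "orbit r c \<subseteq> C \<union> D" using permutes_orbit_subset[OF perm, of c] c by simp
  ultimately have "cyclic_on r (C \<union> D)" using c by (intro cyclic_on_singleI[of c]) auto
  then show thesis using that[OF perm _ square] by blast
qed

text \<open>
  A permutation with only odd cycles has odd order \<open>m\<close>, so its power with exponent
  \<open>(m + 1) / 2\<close> is a square root.
\<close>

lemma odd_cycles_power_root:
  assumes "finite S" "g permutes S" "\<And>C. C \<subseteq> S \<Longrightarrow> cyclic_on g C \<Longrightarrow> odd (card C)"
  obtains k where "0 < k" "g ^^ (2 * k) = g"
proof -
  \<comment> \<open>Any odd common multiple of the cycle lengths serves as exponent; the product of all odd numbers up to \<open>card S\<close> is one.\<close>
  define m where "m = \<Prod>{i \<in> {..card S}. odd i}"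
  have "odd m" by (simp add: m_def even_prod_iff)
  then obtain l where l: "m = 2 * l + 1" by (rule oddE)
  have perm: "permutation g" using assms(1,2) unfolding permutation_permutes by blast
  have "(g ^^ m) x = x" for x
  proof (cases "x \<in> S")
    case True
    have C: "cyclic_on g (orbit g x)" by (rule cyclic_on_orbit'[OF perm])
    have sub: "orbit g x \<subseteq> S" by (rule permutes_orbit_subset[OF assms(2) True])
    have "card (orbit g x) \<in> {i \<in> {..card S}. odd i}"
      using assms(3)[OF sub C] card_mono[OF assms(1) sub] by simp
    then have "card (orbit g x) dvd m" unfolding m_def by (intro dvd_prodI) auto
    then show ?thesis
      using funpow_fixes_iff_card_dvd[OF perm C permutation_self_in_orbit[OF perm]] by blast
  next
    case False
    show ?thesis using permutes_not_in[OF permutes_funpow[OF assms(2)] False] .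
  qed
  then have "g ^^ m = id" by (simp add: fun_eq_iff)
  then have "g ^^ (2 * (l + 1)) = g" using l funpow_add[of 1 m g] by simp
  then show thesis by (rule that[rotated]) simp
qed

text \<open>
  This is the converse of the cycle count of a square: prescribe, for each length \<open>i\<close>, the number \<open>q i\<close> of pairs of
  \<open>i\<close>-cycles of \<open>g\<close> to be merged. All even cycles must be used up, as they have no root on
  their own, while odd cycles may be merged or left alone. Merging a pair lowers one \<open>q i\<close>, and once
  nothing is left to merge only odd cycles remain.
\<close>

lemma ex_square_root:
  assumes "finite S" "g permutes S"
    and "\<And>i. 2 * q i \<le> cycle_count g S i"
    and "\<And>i. even i \<Longrightarrow> 2 * q i = cycle_count g S i"
  shows "\<exists>h. h permutes S \<and> h \<circ> h = g \<and> (\<forall>i. cycle_count h S (2 * i) = q i)"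
  using assms
proof (induction arbitrary: g q rule: finite_psubset_induct)
  case (psubset S)
  note g = psubset.prems(1)
  have perm: "permutation g" using psubset.hyps g unfolding permutation_permutes by blast
  show ?case
  proof (cases "\<exists>i. 0 < q i")
    case False
    then have q: "q i = 0" for i by simp
    have no_even: "cycle_count g S (2 * i) = 0" for i
      using psubset.prems(3)[of "2 * i"] q by simp
    have none: "\<not> (C \<subseteq> S \<and> cyclic_on g C \<and> card C = 2 * i)" for C i
      using no_even[of i] psubset.hyps unfolding cycle_count_def by auto
    then obtain k where k: "0 < k" "g ^^ (2 * k) = g"
      using odd_cycles_power_root[OF psubset.hyps g] by (metis evenE)
    define h where "h = g ^^ k"
    have square: "h \<circ> h = g" using k(2) by (simp add: h_def funpow_add[symmetric] mult_2)
    \<comment> \<open>Since \<open>h\<close> and \<open>g\<close> are powers of each other, the root has no cycles of even length either.\<close>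
    have "orbit h x = orbit g x" for x
    proof
      show "orbit h x \<subseteq> orbit g x" unfolding h_def by (rule orbit_funpow_subset[OF k(1)])
      show "orbit g x \<subseteq> orbit h x"
        using orbit_funpow_subset[of 2 h x] by (simp add: numeral_2_eq_2 square)
    qed
    then have "cyclic_on h C \<longleftrightarrow> cyclic_on g C" for C by (simp add: cyclic_on_def)
    then have "cycle_count h S = cycle_count g S" by (simp add: cycle_count_def fun_eq_iff)
    then show ?thesis
      using permutes_funpow[OF g, of k] square no_even q by (intro exI[of _ h]) (simp add: h_def)
  next
    case True
    then obtain i where i: "0 < q i" by blast
    let ?N = "{C. C \<subseteq> S \<and> cyclic_on g C \<and> card C = i}"
    have "\<not> card ?N \<le> Suc 0"
      using psubset.prems(2)[of i] i by (simp add: cycle_count_def)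
    moreover have "finite ?N" using psubset.hyps by simp
    ultimately obtain C D where CD: "C \<in> ?N" "D \<in> ?N" "C \<noteq> D"
      using card_le_Suc0_iff_eq[of ?N] by blast
    then have C: "C \<subseteq> S" "cyclic_on g C" "card C = i" and D: "D \<subseteq> S" "cyclic_on g D" "card D = i"
      by simp_all
    have disj: "C \<inter> D = {}" by (rule cyclic_on_disjoint[OF C(2) D(2) CD(3)])
    \<comment> \<open>Two cycles of length \<open>i\<close> are merged on \<open>U\<close>; the induction hypothesis supplies a root on the rest \<open>T\<close>.\<close>
    define U where "U = C \<union> D"
    have U: "U \<subseteq> S" "finite U" using C(1) D(1) psubset.hyps finite_subset unfolding U_def by auto
    define T where "T = S - U"
    have T: "T \<subset> S" "finite T" "U \<inter> T = {}" "S = U \<union> T"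
      using U cyclic_on_nonempty[OF C(2)] psubset.hyps unfolding T_def U_def by auto
    have g_U: "g \<in> U \<rightarrow> U"
      using cyclic_on_inI[OF C(2)] cyclic_on_inI[OF D(2)] unfolding U_def by auto
    have g_T: "g \<in> T \<rightarrow> T"
      using permutes_Diff_cyclic_closed[OF g C(2)] permutes_Diff_cyclic_closed[OF g D(2)]
      unfolding T_def U_def by auto
    have "cycle_count g U j = cycle_count g C j + cycle_count g D j" for j
      unfolding U_def
      using cyclic_on_inI[OF C(2)] cyclic_on_inI[OF D(2)] disj U(2)
      by (intro cycle_count_Un) (auto simp: U_def)
    then have count_U: "cycle_count g U j = 2 * of_bool (i = j)" for j
      by (simp add: cycle_count_cyclic[OF C(2)] cycle_count_cyclic[OF D(2)] C(3) D(3))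
    have count_S: "cycle_count g S j = 2 * of_bool (i = j) + cycle_count g T j" for j
      using cycle_count_Un[OF g_U g_T T(3) U(2) T(2), of j] unfolding T(4)[symmetric] count_U .
    let ?g' = "perm_restrict g T"
    let ?q' = "q(i := q i - 1)"
    have g': "?g' permutes T" by (rule perm_restrict_permutes[OF g T(2) g_T])
    have count_g': "cycle_count ?g' T j = cycle_count g T j" for j
      by (rule cycle_count_cong) (simp add: perm_restrict_def)
    have "\<exists>h. h permutes T \<and> h \<circ> h = ?g' \<and> (\<forall>j. cycle_count h T (2 * j) = ?q' j)"
    proof (rule psubset.IH[OF T(1) g'])
      show "2 * ?q' j \<le> cycle_count ?g' T j" for j
        using psubset.prems(2)[of j] count_S[of j] by (auto simp: count_g')
      show "2 * ?q' j = cycle_count ?g' T j" if "even j" for j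
        using psubset.prems(3)[OF that] count_S[of j] by (auto simp: count_g')
    qed
    then obtain h' where h': "h' permutes T" "h' \<circ> h' = ?g'"
      "\<And>j. cycle_count h' T (2 * j) = ?q' j" by blast
    obtain r where r: "r permutes U" "cyclic_on r U" "\<And>x. x \<in> U \<Longrightarrow> r (r x) = g x"
      using ex_merged_cycle[OF perm C(2) D(2) disj] C(3) D(3) unfolding U_def by metis
    define h where "h = r \<circ> h'"
    have h_U: "h x = r x" if "x \<in> U" for x
    proof -
      have "x \<notin> T" using that T(3) by blast
      then show ?thesis by (simp add: h_def permutes_not_in[OF h'(1)])
    qed
    have h_T: "h x = h' x" if "x \<in> T" for x
    proof -
      have "h' x \<in> T" using that permutes_in_image[OF h'(1)] by simp
      then show ?thesis using permutes_not_in[OF r(1), of "h' x"] T(3) by (auto simp: h_def)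
    qed
    have r_U: "r x \<in> U" if "x \<in> U" for x using permutes_in_image[OF r(1)] that by simp
    have h'_T: "h' x \<in> T" if "x \<in> T" for x using permutes_in_image[OF h'(1)] that by simp
    have "h permutes S"
      unfolding h_def
      by (rule permutes_compose[OF permutes_subset[OF h'(1)] permutes_subset[OF r(1)]])
        (use T in auto)
    moreover have "h \<circ> h = g"
    proof
      fix x
      consider "x \<in> U" | "x \<in> T" | "x \<notin> S" using T(4) by blast
      then show "(h \<circ> h) x = g x"
      proof cases
        case 1
        then show ?thesis using r(3)[of x] r_U[of x] by (simp add: h_U)
      next
        case 2
        then have "h' (h' x) = g x"
          using fun_cong[OF h'(2), of x] by (simp add: perm_restrict_def)
        then show ?thesis using 2 h'_T[of x] by (simp add: h_T)
      next
        case 3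
        then show ?thesis
          using permutes_not_in[OF g 3] permutes_not_in[OF \<open>h permutes S\<close> 3] by simp
      qed
    qed
    moreover have "cycle_count h S (2 * j) = q j" for j
    proof -
      have "cycle_count h (U \<union> T) (2 * j) = cycle_count h U (2 * j) + cycle_count h T (2 * j)"
        using T(3) U(2) T(2) by (intro cycle_count_Un) (auto simp: h_U h_T r_U h'_T)
      also have "cycle_count h U (2 * j) = cycle_count r U (2 * j)"
        by (rule cycle_count_cong) (rule h_U)
      also have "\<dots> = of_bool (i = j)"
      proof -
        have "card U = 2 * i"
          using card_Un_disjoint[OF _ _ disj] finite_cyclic_on[OF C(2)] finite_cyclic_on[OF D(2)]
            C(3) D(3) by (simp add: U_def)
        then show ?thesis by (simp add: cycle_count_cyclic[OF r(2)])
      qed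
      also have "cycle_count h T (2 * j) = cycle_count h' T (2 * j)"
        by (rule cycle_count_cong) (rule h_T)
      finally show ?thesis using i by (simp add: h'(3) T(4)[symmetric])
    qed
    ultimately show ?thesis by blast
  qed
qed

section \<open>Which permutations are squares\<close>

lemma square_root_iff:
  assumes "finite S" "g permutes S"
  shows "(\<exists>h. h permutes S \<and> h \<circ> h = g) \<longleftrightarrow> (\<forall>i. even i \<longrightarrow> even (cycle_count g S i))"
proof
  assume "\<exists>h. h permutes S \<and> h \<circ> h = g"
  then obtain h where "h permutes S" "h \<circ> h = g" by blast
  then show "\<forall>i. even i \<longrightarrow> even (cycle_count g S i)"
    using cycle_count_square[OF assms(1) \<open>h permutes S\<close>] by auto
next
  assume even: "\<forall>i. even i \<longrightarrow> even (cycle_count g S i)"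
  define q where "q i = (if even i then cycle_count g S i div 2 else 0)" for i
  have "2 * q i \<le> cycle_count g S i" "even i \<Longrightarrow> 2 * q i = cycle_count g S i" for i
    using even by (auto simp: q_def)
  then show "\<exists>h. h permutes S \<and> h \<circ> h = g"
    using ex_square_root[OF assms, of q] by blast
qed

text \<open>
  The number \<open>q i\<close> counts at once the merged pairs of \<open>i\<close>-cycles of \<open>g\<close> and the \<open>2 * i\<close>-cycles
  of the root. The latter decide its parity, so what parities a root can have is a question about the
  admissible \<open>q\<close> alone.
\<close>

lemma even_square_root_iff:
  assumes "finite S" "g permutes S" "card S \<le> M"
  shows "(\<exists>h. h permutes S \<and> h \<circ> h = g \<and> evenperm h) \<longleftrightarrow>
    (\<exists>q. (\<forall>i. 2 * q i \<le> cycle_count g S i) \<and> (\<forall>i. even i \<longrightarrow> 2 * q i = cycle_count g S i) \<and>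
      even (\<Sum>i=1..M. q i))" (is "?L \<longleftrightarrow> ?R")
proof
  assume ?L
  then obtain h where h: "h permutes S" "h \<circ> h = g" "evenperm h" by blast
  have "cycle_count g S i = 2 * cycle_count h S (2 * i) + (if odd i then cycle_count h S i else 0)" for i
    using cycle_count_square[OF assms(1) h(1), of i] unfolding h(2) .
  then show ?R
    using evenperm_iff_even_cycles[OF assms(1) h(1) assms(3)] h(3)
    by (intro exI[of _ "\<lambda>i. cycle_count h S (2 * i)"]) simp
next
  assume ?R
  then obtain q where q: "\<And>i. 2 * q i \<le> cycle_count g S i"
    "\<And>i. even i \<Longrightarrow> 2 * q i = cycle_count g S i" "even (\<Sum>i=1..M. q i)" by blast
  obtain h where h: "h permutes S" "h \<circ> h = g" "\<And>i. cycle_count h S (2 * i) = q i"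
    using ex_square_root[OF assms(1,2) q(1,2)] by blast
  then show ?L
    using evenperm_iff_even_cycles[OF assms(1) h(1) assms(3)] q(3) by auto
qed

section \<open>Squares in the alternating and symmetric groups\<close>

lemma num_cycles_eq: "num_cycles n g i = cycle_count g {1..n} i"
  by (simp add: num_cycles_def cycles_of_length_def cycle_count_def)

text \<open>
  Having two fixed points is thus a special case of having two cycles of equal odd length.
\<close>

lemma card_Fix_le: "card (Fix n g) \<le> num_cycles n g 1"
proof -
  have "(\<lambda>x. {x}) ` Fix n g \<subseteq> cycles_of_length n g 1"
  proof (rule image_subsetI)
    fix x assume x: "x \<in> Fix n g"
    then have "{x} = orbit g x" by (simp add: Fix_def orbit_eq_singleton_iff[THEN iffD2])
    then have "cyclic_on g {x}" by (intro cyclic_on_singleI) auto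
    then show "{x} \<in> cycles_of_length n g 1" using x by (simp add: cycles_of_length_def Fix_def)
  qed
  moreover have "finite (cycles_of_length n g 1)"
    by (rule finite_subset[of _ "Pow {1..n}"]) (auto simp: cycles_of_length_def)
  ultimately have "card ((\<lambda>x. {x}) ` Fix n g) \<le> num_cycles n g 1"
    unfolding num_cycles_def by (rule card_mono[rotated])
  then show ?thesis by (simp add: card_image)
qed

lemma alt_group_square: "h [^]\<^bsub>alt_group n\<^esub> (2::nat) = h \<circ> h"
  by (simp add: nat_pow_def numeral_2_eq_2 alt_group_mult alt_group_one)

lemma sym_group_square: "h [^]\<^bsub>sym_group n\<^esub> (2::nat) = h \<circ> h"
  by (simp add: nat_pow_def numeral_2_eq_2 sym_group_mult sym_group_one)

lemma all_even_iff:
  "(\<forall>i. even i \<longrightarrow> even (num_cycles n g i)) \<longleftrightarrow> (\<forall>k\<ge>1. even (num_cycles n g (2 * k)))"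
proof
  assume R: "\<forall>k\<ge>1. even (num_cycles n g (2 * k))"
  show "\<forall>i. even i \<longrightarrow> even (num_cycles n g i)"
  proof (intro allI impI)
    fix i :: nat assume "even i"
    then obtain k where k: "i = 2 * k" by blast
    show "even (num_cycles n g i)"
      using R k by (cases "k = 0") (simp_all add: num_cycles_eq cycle_count_0)
  qed
qed simp

lemma sum_supported_on_even:
  fixes q :: "nat \<Rightarrow> nat"
  assumes "\<And>i. odd i \<Longrightarrow> q i = 0" "\<And>i. i > n \<Longrightarrow> q i = 0"
  shows "(\<Sum>i=1..n. q i) = (\<Sum>l=1..n. q (2 * l))"
proof -
  have "(\<Sum>i=1..n. q i) = (\<Sum>i=1..2*n. q i)"
    using assms(2) by (intro sum.mono_neutral_left) auto
  also have "\<dots> = sum q ((*) 2 ` {1..n})"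
  proof (rule sum.mono_neutral_right)
    have "q i = 0" if "i \<in> {1..2*n}" "i \<notin> (*) 2 ` {1..n}" for i
    proof (rule assms(1), rule notI)
      assume "even i"
      then obtain l where "i = 2 * l" by blast
      then show False using that by auto
    qed
    then show "\<forall>i\<in>{1..2*n} - (*) 2 ` {1..n}. q i = 0" by blast
  qed auto
  also have "\<dots> = (\<Sum>l=1..n. q (2 * l))"
    by (subst sum.reindex) (auto simp: inj_on_def)
  finally show ?thesis .
qed

text \<open>
  If no odd length is repeated, the admissible \<open>q\<close> is unique and its sum is the number of pairs of
  even cycles. If some odd length is repeated, merging one pair of that length changes the parity
  of the sum, so an even root exists as soon as the cycles of even length can be paired.
\<close>

lemma alternating_square_root_iff:
  assumes "g permutes {1..n}"
  shows "(\<exists>h. h permutes {1..n} \<and> h \<circ> h = g \<and> evenperm h) \<longleftrightarrow>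
    (\<forall>k\<ge>1. even (num_cycles n g (2 * k))) \<and>
    ((\<exists>i. odd i \<and> num_cycles n g i > 1) \<or> even (\<Sum>l = 1..n. num_cycle_pairs n g (2 * l)))"
    (is "?L \<longleftrightarrow> ?E \<and> (?O \<or> ?P)")
proof -
  define p where "p i = (if even i then num_cycles n g i div 2 else 0)" for i
  have p_sum: "(\<Sum>i=1..n. p i) = (\<Sum>l = 1..n. num_cycle_pairs n g (2 * l))"
    by (subst sum_supported_on_even) (auto simp: p_def num_cycle_pairs_def num_cycles_eq_0)
  have L_iff: "?L \<longleftrightarrow> (\<exists>q. (\<forall>i. 2 * q i \<le> num_cycles n g i) \<and>
      (\<forall>i. even i \<longrightarrow> 2 * q i = num_cycles n g i) \<and> even (\<Sum>i=1..n. q i))"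
    using even_square_root_iff[of "{1..n}" g n] assms by (simp add: num_cycles_eq)
  show ?thesis
  proof
    assume ?L
    then obtain q where q: "\<And>i. 2 * q i \<le> num_cycles n g i"
      "\<And>i. even i \<Longrightarrow> 2 * q i = num_cycles n g i" "even (\<Sum>i=1..n. q i)"
      unfolding L_iff by blast
    have "even (num_cycles n g (2 * k))" for k
      using q(2)[of "2 * k"] by (metis dvd_triv_left)
    moreover have ?P if "\<not> ?O"
    proof -
      have "q i = p i" for i
      proof (cases "even i")
        case True
        then show ?thesis using q(2)[OF True] by (simp add: p_def)
      next
        case False
        then show ?thesis using that q(1)[of i] by (auto simp: p_def not_less)
      qed
      then show ?thesis using q(3) p_sum by simp
    qed
    ultimately show "?E \<and> (?O \<or> ?P)" by blast
  next
    assume R: "?E \<and> (?O \<or> ?P)"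
    then have even: "even (num_cycles n g i)" if "even i" for i
      using all_even_iff that by blast
    have p: "2 * p i \<le> num_cycles n g i" "even i \<Longrightarrow> 2 * p i = num_cycles n g i" for i
      using even[of i] by (auto simp: p_def)
    show ?L
    proof (cases "even (\<Sum>i=1..n. p i)")
      case True
      then show ?thesis unfolding L_iff using p by blast
    next
      case False
      then obtain i where i: "odd i" "num_cycles n g i > 1" using R p_sum by auto
      \<comment> \<open>Joining one pair of the repeated odd length \<open>i\<close> corrects the parity.\<close>
      have "i \<in> {1..n}"
        using i num_cycles_eq_0[of n i g] odd_pos[of i] by (cases "i \<le> n") auto
      then have "(\<Sum>j=1..n. (p(i := 1)) j) = 1 + (\<Sum>j\<in>{1..n} - {i}. p j)"
        by (subst sum.remove[of _ i]) auto
      moreover have "(\<Sum>j=1..n. p j) = (\<Sum>j\<in>{1..n} - {i}. p j)"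
        using \<open>i \<in> {1..n}\<close> i(1) by (subst sum.remove[of _ i]) (auto simp: p_def)
      ultimately have "even (\<Sum>j=1..n. (p(i := 1)) j)" using False by simp
      moreover have "2 * (p(i := 1)) j \<le> num_cycles n g j"
        "even j \<Longrightarrow> 2 * (p(i := 1)) j = num_cycles n g j" for j
        using p[of j] i by auto
      ultimately show ?thesis unfolding L_iff by blast
    qed
  qed
qed

text \<open>
  The maximum is attained, although the index \<open>k\<close> is unbounded, because only finitely many values
  occur; and fixed points are cycles of the odd length 1.
\<close>

lemma repeated_odd_length_iff:
  "(card (Fix n g) > 1 \<or> Max ((\<lambda>k. num_cycles n g (2 * k - 1)) ` {1..}) > 1) \<longleftrightarrow>
    (\<exists>i. odd i \<and> num_cycles n g i > 1)"
proof -
  have "Max ((\<lambda>k. num_cycles n g (2 * k - 1)) ` {1..}) > 1 \<longleftrightarrow>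
      (\<exists>k\<ge>1. num_cycles n g (2 * k - 1) > 1)"
    by (subst Max_gr_iff) (auto simp: finite_range_num_cycles)
  also have "\<dots> \<longleftrightarrow> (\<exists>i. odd i \<and> num_cycles n g i > 1)"
  proof
    assume "\<exists>k\<ge>1. num_cycles n g (2 * k - 1) > 1"
    then obtain k where "k \<ge> 1" "num_cycles n g (2 * k - 1) > 1" by blast
    moreover have "odd (2 * k - 1)" using \<open>k \<ge> 1\<close> by simp
    ultimately show "\<exists>i. odd i \<and> num_cycles n g i > 1" by blast
  next
    assume "\<exists>i. odd i \<and> num_cycles n g i > 1"
    then obtain l where "num_cycles n g (2 * l + 1) > 1" by (blast elim: oddE)
    then show "\<exists>k\<ge>1. num_cycles n g (2 * k - 1) > 1" by (intro exI[of _ "l + 1"]) simp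
  qed
  moreover have "\<exists>i. odd i \<and> num_cycles n g i > 1" if "card (Fix n g) > 1"
    using that card_Fix_le[of n g] by (intro exI[of _ 1]) simp
  ultimately show ?thesis by blast
qed

theorem theorem6:
  fixes n :: nat
  shows
    "(\<forall>g \<in> carrier (alt_group n).
        (\<exists>h \<in> carrier (alt_group n). g = h [^]\<^bsub>alt_group n\<^esub> (2::nat)) \<longleftrightarrow>
        (\<forall>k\<ge>1. even (num_cycles n g (2 * k))) \<and>
        ((card (Fix n g) > 1 \<or> Max ((\<lambda>k. num_cycles n g (2 * k - 1)) ` {1..}) > 1) \<or>
         even (\<Sum>l = 1..n. num_cycle_pairs n g (2 * l)))) \<and>
     (\<forall>g \<in> carrier (sym_group n).
        (\<exists>h \<in> carrier (sym_group n). g = h [^]\<^bsub>sym_group n\<^esub> (2::nat)) \<longleftrightarrow>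
        (\<forall>l\<ge>1. even (num_cycles n g (2 * l))))"
proof (intro conjI ballI)
  fix g assume "g \<in> carrier (alt_group n)"
  then have g: "g permutes {1..n}" by (simp add: alt_group_carrier)
  have "(\<exists>h \<in> carrier (alt_group n). g = h [^]\<^bsub>alt_group n\<^esub> (2::nat)) \<longleftrightarrow>
      (\<exists>h. h permutes {1..n} \<and> h \<circ> h = g \<and> evenperm h)"
    unfolding alt_group_square Bex_def alt_group_carrier by blast
  then show "(\<exists>h \<in> carrier (alt_group n). g = h [^]\<^bsub>alt_group n\<^esub> (2::nat)) \<longleftrightarrow>
        (\<forall>k\<ge>1. even (num_cycles n g (2 * k))) \<and>
        ((card (Fix n g) > 1 \<or> Max ((\<lambda>k. num_cycles n g (2 * k - 1)) ` {1..}) > 1) \<or>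
         even (\<Sum>l = 1..n. num_cycle_pairs n g (2 * l)))"
    unfolding alternating_square_root_iff[OF g] repeated_odd_length_iff .
next
  fix g assume "g \<in> carrier (sym_group n)"
  then have g: "g permutes {1..n}" by (simp add: sym_group_carrier)
  have "(\<exists>h \<in> carrier (sym_group n). g = h [^]\<^bsub>sym_group n\<^esub> (2::nat)) \<longleftrightarrow>
      (\<exists>h. h permutes {1..n} \<and> h \<circ> h = g)"
    unfolding sym_group_square Bex_def sym_group_carrier by blast
  also have "\<dots> \<longleftrightarrow> (\<forall>i. even i \<longrightarrow> even (num_cycles n g i))"
    using square_root_iff[OF _ g] by (simp add: num_cycles_eq)
  finally show "(\<exists>h \<in> carrier (sym_group n). g = h [^]\<^bsub>sym_group n\<^esub> (2::nat)) \<longleftrightarrow>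
        (\<forall>l\<ge>1. even (num_cycles n g (2 * l)))"
    unfolding all_even_iff .
qed

end
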